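(* Let $\mathcal{X}$ be a measurable space in which points are measurable, let $\nu$ be a probability measure on $\mathcal{X}$, let $(\mathcal{F},\lVert\cdot\rVert_{\mathcal{F}})$ be a Banach space of measurable functions $f:\mathcal{X}\to\mathbb{R}$ on which point evaluation is bounded, and let $T:\mathcal{F}\to\mathbb{R}$ be a bounded linear functional; if $\{T(f):f\in\mathcal{F}\}\neq\{0\}$, assume that $\mathcal{F}$ contains the constant functions. Assume $\nu\in\mathcal{M}$. With $\mathcal{M}$, $\mathcal{M}_\bot$, $\mathcal{M}_{\mathrm{S}}$, $\mathrm{VAR}^{\mathrm{D}}$, $\mathrm{DSC}^{\mathrm{D}}$ and $\mathrm{CNF}^{\mathrm{D}}$ as defined in the context, for every $f\in\mathcal{F}$ and every sampling measure $\widehat{\nu}\in\mathcal{M}_{\mathrm{S}}$ with $\nu-\widehat{\nu}\in\mathcal{M}_\bot$, the quantities $\mu=\int_{\mathcal{X}}f(\boldsymbol{x})\,\nu(\mathrm{d}\boldsymbol{x})$ and $\widehat{\mu}=\int_{\mathcal{X}}f(\boldsymbol{x})\,\widehat{\nu}(\mathrm{d}\boldsymbol{x})$ satisfy $$\mu-\widehat{\mu}=\mathrm{CNF}^{\mathrm{D}}(f,\nu-\widehat{\nu})\;\mathrm{DSC}^{\mathrm{D}}(\nu-\widehat{\nu})\;\mathrm{VAR}^{\mathrm{D}}(f).$$ Moreover, $\bigl|\mathrm{CNF}^{\mathrm{D}}(f,\nu-\widehat{\nu})\bigr|\le 1$.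
   Context: Sampling measures: $\mathcal{M}_{\mathrm{S}}=\bigl\{\sum_{i=1}^n w_i\delta_{\boldsymbol{x}_i}: w_1,\dots,w_n\in\mathbb{R},\ \boldsymbol{x}_1,\dots,\boldsymbol{x}_n\in\mathcal{X},\ n\in\mathbb{N}\bigr\}$, where $\delta_{\boldsymbol{t}}$ is the Dirac measure at $\boldsymbol{t}$. For $\widehat{\nu}=\sum_i w_i\delta_{\boldsymbol{x}_i}$, $\int f\,\mathrm{d}\widehat{\nu}=\sum_i w_i f(\boldsymbol{x}_i)$. Bounded point evaluation means $\sup_{f\in\mathcal{F},\,f\ne0}|f(\boldsymbol{t})|/\lVert f\rVert_{\mathcal{F}}<\infty$ for every $\boldsymbol{t}\in\mathcal{X}$. The number $T(f)$ is also regarded as the constant function with that value. The deterministic variation is $\mathrm{VAR}^{\mathrm{D}}(f):=\lVert f-T(f)\rVert_{\mathcal{F}}$ for $f\in\mathcal{F}$. $\mathcal{M}$ is the vector space of signed measures $\eta$ on $\mathcal{X}$ such that $\int_{\mathcal{X}}f\,\mathrm{d}\eta$ is finite for all $f\in\mathcal{F}$ (so $\mathcal{M}_{\mathrm{S}}\subseteq\mathcal{M}$). The subspace $\mathcal{M}_\bot$ is $\{\eta\in\mathcal{M}:\eta(\mathcal{X})=0\}$ if $\{T(f):f\in\mathcal{F}\}\neq\{0\}$, and $\mathcal{M}_\bot=\mathcal{M}$ if $\{T(f):f\in\mathcal{F}\}=\{0\}$. For $\eta\in\mathcal{M}_\bot$, $$\lVert\eta\rVert_{\mathcal{M}_\bot}:=\sup_{f\in\mathcal{F}:\,f\neq0}\frac{\bigl|\int_{\mathcal{X}}f(\boldsymbol{x})\,\eta(\mathrm{d}\boldsymbol{x})\bigr|}{\lVert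 f\rVert_{\mathcal{F}}},$$ and the deterministic discrepancy is $\mathrm{DSC}^{\mathrm{D}}(\nu-\widehat{\nu}):=\lVert\nu-\widehat{\nu}\rVert_{\mathcal{M}_\bot}$. The deterministic confounding is $$\mathrm{CNF}^{\mathrm{D}}(f,\nu-\widehat{\nu}):=\frac{\int_{\mathcal{X}}f(\boldsymbol{x})\,(\nu-\widehat{\nu})(\mathrm{d}\boldsymbol{x})}{\mathrm{VAR}^{\mathrm{D}}(f)\,\mathrm{DSC}^{\mathrm{D}}(\nu-\widehat{\nu})}$$ if $\mathrm{VAR}^{\mathrm{D}}(f)\,\mathrm{DSC}^{\mathrm{D}}(\nu-\widehat{\nu})\neq0$, and $0$ otherwise. *)

theory Defs
  imports "HOL-Probability.Probability" "HOL-Library.Function_Algebras"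
begin

text \<open>
  The measurable space is \<open>space M\<close> with the sigma-algebra \<open>sets M\<close>; the measure carried by
  \<open>M\<close> is never used. A real function on \<open>space M\<close> is represented by its extension by 0 to the
  whole type, so that functions on \<open>space M\<close> form a vector space under the pointwise operations.
\<close>

definition const_on :: "'a measure \<Rightarrow> real \<Rightarrow> 'a \<Rightarrow> real" where
  "const_on M c = (\<lambda>x. if x \<in> space M then c else 0)"

locale banach_function_space =
  fixes M :: "'a measure" and F :: "('a \<Rightarrow> real) set" and nrm :: "('a \<Rightarrow> real) \<Rightarrow> real"
  assumes zero_outside: "f \<in> F \<Longrightarrow> x \<notin> space M \<Longrightarrow> f x = 0"
    and measurable: "f \<in> F \<Longrightarrow> f \<in> borel_measurable M"
    and zero_mem: "0 \<in> F"
    and add_mem: "f \<in> F \<Longrightarrow> g \<in> F \<Longrightarrow> f + g \<in> F"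
    and scale_mem: "f \<in> F \<Longrightarrow> (\<lambda>x. c * f x) \<in> F"
    and nrm_nonneg: "f \<in> F \<Longrightarrow> 0 \<le> nrm f"
    and nrm_eq_0_iff: "f \<in> F \<Longrightarrow> nrm f = 0 \<longleftrightarrow> f = 0"
    and nrm_triangle: "f \<in> F \<Longrightarrow> g \<in> F \<Longrightarrow> nrm (f + g) \<le> nrm f + nrm g"
    and nrm_scale: "f \<in> F \<Longrightarrow> nrm (\<lambda>x. c * f x) = \<bar>c\<bar> * nrm f"
    and complete:
      "(\<And>n. s n \<in> F) \<Longrightarrow> (\<And>e. 0 < e \<Longrightarrow> \<exists>N. \<forall>m\<ge>N. \<forall>n\<ge>N. nrm (s m - s n) < e)
        \<Longrightarrow> \<exists>f\<in>F. (\<lambda>n. nrm (s n - f)) \<longlonglongrightarrow> 0"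

definition bounded_point_evaluation ::
  "'a measure \<Rightarrow> ('a \<Rightarrow> real) set \<Rightarrow> (('a \<Rightarrow> real) \<Rightarrow> real) \<Rightarrow> bool" where
  "bounded_point_evaluation M F nrm \<longleftrightarrow>
    (\<forall>t\<in>space M. bdd_above ((\<lambda>f. \<bar>f t\<bar> / nrm f) ` (F - {0})))"

definition bounded_linear_functional_on ::
  "('a \<Rightarrow> real) set \<Rightarrow> (('a \<Rightarrow> real) \<Rightarrow> real) \<Rightarrow> (('a \<Rightarrow> real) \<Rightarrow> real) \<Rightarrow> bool" where
  "bounded_linear_functional_on F nrm T \<longleftrightarrow>
    (\<forall>f\<in>F. \<forall>g\<in>F. T (f + g) = T f + T g) \<and>
    (\<forall>f\<in>F. \<forall>c. T (\<lambda>x. c * f x) = c * T f) \<and>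
    (\<exists>K. \<forall>f\<in>F. \<bar>T f\<bar> \<le> K * nrm f)"

text \<open>
  Signed measures are real-valued (hence finite), which makes them a vector space. Like
  \<^const>\<open>measure\<close>, they are extended by 0 to non-measurable sets, so that equality of signed
  measures is equality of set functions. Countable additivity includes \<open>\<eta> {} = 0\<close>.
\<close>

definition signed_measure :: "'a measure \<Rightarrow> ('a set \<Rightarrow> real) \<Rightarrow> bool" where
  "signed_measure M \<eta> \<longleftrightarrow>
    (\<forall>A. A \<notin> sets M \<longrightarrow> \<eta> A = 0) \<and>
    (\<forall>A :: nat \<Rightarrow> 'a set. range A \<subseteq> sets M \<longrightarrow> disjoint_family A \<longrightarrow>
      (\<lambda>i. \<eta> (A i)) sums \<eta> (\<Union>i. A i))"

text \<open>
  The Jordan decomposition of \<open>\<eta>\<close> is \<open>pos_part M \<eta>\<close>, \<open>pos_part M (- \<eta>)\<close>, where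
  \<open>\<eta>\<^sup>+ A\<close> is the supremum of \<open>\<eta> B\<close> over the measurable \<open>B \<subseteq> A\<close>. The truncation of negative
  values by \<^const>\<open>ennreal\<close> does not affect the supremum, because \<open>B = {}\<close> contributes 0.
\<close>

definition pos_part :: "'a measure \<Rightarrow> ('a set \<Rightarrow> real) \<Rightarrow> 'a measure" where
  "pos_part M \<eta> =
    measure_of (space M) (sets M) (\<lambda>A. SUP B\<in>{B \<in> sets M. B \<subseteq> A}. ennreal (\<eta> B))"

definition signed_integrable :: "'a measure \<Rightarrow> ('a set \<Rightarrow> real) \<Rightarrow> ('a \<Rightarrow> real) \<Rightarrow> bool" where
  "signed_integrable M \<eta> f \<longleftrightarrow>
    integrable (pos_part M \<eta>) f \<and> integrable (pos_part M (- \<eta>)) f"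

definition signed_integral :: "'a measure \<Rightarrow> ('a set \<Rightarrow> real) \<Rightarrow> ('a \<Rightarrow> real) \<Rightarrow> real" where
  "signed_integral M \<eta> f =
    (LINT x|pos_part M \<eta>. f x) - (LINT x|pos_part M (- \<eta>). f x)"

definition signed_measures_on :: "'a measure \<Rightarrow> ('a \<Rightarrow> real) set \<Rightarrow> ('a set \<Rightarrow> real) set" where
  "signed_measures_on M F = {\<eta>. signed_measure M \<eta> \<and> (\<forall>f\<in>F. signed_integrable M \<eta> f)}"

definition signed_measures_perp ::
  "'a measure \<Rightarrow> ('a \<Rightarrow> real) set \<Rightarrow> (('a \<Rightarrow> real) \<Rightarrow> real) \<Rightarrow> ('a set \<Rightarrow> real) set" where
  "signed_measures_perp M F T =
    (if T ` F \<noteq> {0} then {\<eta> \<in> signed_measures_on M F. \<eta> (space M) = 0}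
     else signed_measures_on M F)"

definition sampling_measures :: "'a measure \<Rightarrow> ('a set \<Rightarrow> real) set" where
  "sampling_measures M =
    {\<eta>. \<exists>(n::nat) w x. (\<forall>i<n. x i \<in> space M) \<and>
      \<eta> = (\<lambda>A. \<Sum>i<n. w i * measure (return M (x i)) A)}"

definition VAR_D ::
  "'a measure \<Rightarrow> (('a \<Rightarrow> real) \<Rightarrow> real) \<Rightarrow> (('a \<Rightarrow> real) \<Rightarrow> real) \<Rightarrow> ('a \<Rightarrow> real) \<Rightarrow> real" where
  "VAR_D M nrm T f = nrm (f - const_on M (T f))"

text \<open>
  Inserting 0 into the set of (nonnegative) quotients only matters for \<open>F = {0}\<close>, where it gives
  the supremum over the empty set its value 0. The supremum is taken in the reals: when \<open>F\<close> is a
  Banach space with bounded point evaluation and every \<open>f \<in> F\<close> is \<open>\<eta>\<close>-integrable, the quotients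
  are bounded by the closed graph theorem, applied to the inclusion of \<open>F\<close> into \<open>L\<^sup>1(|\<eta>|)\<close>.
\<close>

definition DSC_D ::
  "'a measure \<Rightarrow> ('a \<Rightarrow> real) set \<Rightarrow> (('a \<Rightarrow> real) \<Rightarrow> real) \<Rightarrow> ('a set \<Rightarrow> real) \<Rightarrow> real" where
  "DSC_D M F nrm \<eta> =
    Sup (insert 0 ((\<lambda>f. \<bar>signed_integral M \<eta> f\<bar> / nrm f) ` (F - {0})))"

definition CNF_D ::
  "'a measure \<Rightarrow> ('a \<Rightarrow> real) set \<Rightarrow> (('a \<Rightarrow> real) \<Rightarrow> real) \<Rightarrow> (('a \<Rightarrow> real) \<Rightarrow> real) \<Rightarrow>
    ('a \<Rightarrow> real) \<Rightarrow> ('a set \<Rightarrow> real) \<Rightarrow> real" where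
  "CNF_D M F nrm T f \<eta> =
    (if VAR_D M nrm T f * DSC_D M F nrm \<eta> \<noteq> 0
     then signed_integral M \<eta> f / (VAR_D M nrm T f * DSC_D M F nrm \<eta>)
     else 0)"

end

theory Submission
  imports Defs
begin

text \<open>
  Write \<open>\<eta> = \<nu> - \<nu>'\<close> and \<open>g = f - T f\<close>. The identity is the definition of the confounding solved
  for the error \<open>\<integral> f d\<eta>\<close>, so all the content lies in the inequality of Koksma-Hlawka type
  \<open>\<bar>\<integral> f d\<eta>\<bar> \<le> DSC \<eta> * VAR f\<close>: it bounds the confounding by 1, and it shows that the error is 0
  when the confounding takes its default value 0 (\<open>CNF_D_factorization\<close>).

  To prove the inequality, replace \<open>f\<close> by \<open>g\<close>. This does not change the integral: either \<open>T = 0\<close>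
  on \<open>F\<close> and \<open>g = f\<close>, or \<open>\<eta>\<close> has total mass 0 and annihilates constants
  (\<open>signed_integral_minus_const_on\<close>). Since \<open>\<parallel>g\<parallel> = VAR f\<close>, it remains to see that
  \<open>\<bar>\<integral> g d\<eta>\<bar> \<le> DSC \<eta> * \<parallel>g\<parallel>\<close>, which holds by definition of the supremum provided that the supremum
  is finite (\<open>abs_signed_integral_le_DSC_D\<close>). Two points need work.

  Finiteness says that integration is a bounded functional on \<open>F\<close>, although only integrability of
  each single function is assumed. That is an instance of the closed graph theorem; it is proved here from Baire's theorem and Fatou's lemma (\<open>integral_bounded\<close>).

  Moreover, the integral against a signed measure is defined through the Jordan decomposition,
  which is not additive. That \<open>\<integral> f d\<eta> = \<integral> f d\<nu> - \<integral> f d\<nu>'\<close> is proved by passing to densities with respect to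
  a common dominating measure (\<open>signed_integral_linear_combination\<close>).
\<close>

section \<open>Integration against signed measures\<close>

text \<open>
  If \<open>\<eta>\<close> has density \<open>h\<close>, the positivity set of \<open>h\<close> is a Hahn set: among the measurable
  \<open>B \<subseteq> A\<close>, the value \<open>\<eta> B\<close> is largest for \<open>B = A \<inter> {h > 0}\<close>. Since \<^const>\<open>ennreal\<close> truncates
  negative numbers to 0, \<open>ennreal \<circ> h\<close> is already the density of \<open>\<eta>\<^sup>+\<close>.
\<close>

lemma pos_part_eq_density:
  assumes [measurable_cong]: "sets \<mu> = sets M" and h: "integrable \<mu> h"
    and \<eta>: "\<And>A. A \<in> sets M \<Longrightarrow> \<eta> A = (LINT x:A|\<mu>. h x)"
  shows "pos_part M \<eta> = density \<mu> (\<lambda>x. ennreal (h x))"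
proof -
  note [measurable] = borel_measurable_integrable[OF h]
  have sp: "space \<mu> = space M" using assms(1) by (rule sets_eq_imp_space_eq)
  have sup: "(SUP B\<in>{B \<in> sets M. B \<subseteq> A}. ennreal (\<eta> B)) = emeasure (density \<mu> (\<lambda>x. ennreal (h x))) A"
    if A: "A \<in> sets M" for A
  proof (rule antisym)
    have A': "A \<in> sets \<mu>" using A assms(1) by simp
    show "(SUP B\<in>{B \<in> sets M. B \<subseteq> A}. ennreal (\<eta> B)) \<le> emeasure (density \<mu> (\<lambda>x. ennreal (h x))) A"
    proof (rule SUP_least, clarify)
      fix B assume B: "B \<in> sets M" "B \<subseteq> A"
      then have B': "B \<in> sets \<mu>" using assms(1) by simp
      have hB: "integrable \<mu> (\<lambda>x. indicator B x *\<^sub>R h x)"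
        by (rule integrable_mult_indicator[OF B' h])
      have "ennreal (\<eta> B) \<le> ennreal (LINT x|\<mu>. max 0 (indicator B x *\<^sub>R h x))"
        unfolding \<eta>[OF B(1)] set_lebesgue_integral_def
        using hB by (intro ennreal_leI integral_mono) auto
      also have "\<dots> = (\<integral>\<^sup>+x. ennreal (max 0 (indicator B x *\<^sub>R h x)) \<partial>\<mu>)"
        using hB by (intro nn_integral_eq_integral[symmetric]) auto
      also have "\<dots> \<le> (\<integral>\<^sup>+x. ennreal (h x) * indicator A x \<partial>\<mu>)"
        using B by (intro nn_integral_mono) (auto simp: ennreal_max_0 split: split_indicator)
      also have "\<dots> = emeasure (density \<mu> (\<lambda>x. ennreal (h x))) A"
        using A' by (simp add: emeasure_density)
      finally show "ennreal (\<eta> B) \<le> emeasure (density \<mu> (\<lambda>x. ennreal (h x))) A" .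
    qed
    \<comment> \<open>the supremum is attained at the Hahn set\<close>
    let ?B = "A \<inter> {x \<in> space M. 0 < h x}"
    have B'[measurable]: "?B \<in> sets \<mu>" using A' by (simp add: sp[symmetric])
    then have B: "?B \<in> sets M" using assms(1) by simp
    have "emeasure (density \<mu> (\<lambda>x. ennreal (h x))) A = (\<integral>\<^sup>+x. ennreal (h x) * indicator A x \<partial>\<mu>)"
      using A' by (simp add: emeasure_density)
    also have "\<dots> = (\<integral>\<^sup>+x. ennreal (indicator ?B x *\<^sub>R h x) \<partial>\<mu>)"
      by (intro nn_integral_cong) (auto simp: sp ennreal_neg split: split_indicator)
    also have "\<dots> = ennreal (\<eta> ?B)"
      unfolding \<eta>[OF B] set_lebesgue_integral_def
      using integrable_mult_indicator[OF B' h]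
      by (intro nn_integral_eq_integral) (auto split: split_indicator)
    also have "\<dots> \<le> (SUP B\<in>{B \<in> sets M. B \<subseteq> A}. ennreal (\<eta> B))"
      using B by (intro SUP_upper) auto
    finally show "emeasure (density \<mu> (\<lambda>x. ennreal (h x))) A \<le> (SUP B\<in>{B \<in> sets M. B \<subseteq> A}. ennreal (\<eta> B))" .
  qed
  have "pos_part M \<eta> = measure_of (space M) (sets M) (emeasure (density \<mu> (\<lambda>x. ennreal (h x))))"
    unfolding pos_part_def
    by (rule measure_of_eq) (auto simp: sets.space_closed sets.sigma_sets_eq sup)
  also have "\<dots> = density \<mu> (\<lambda>x. ennreal (h x))"
    using measure_of_of_measure[of "density \<mu> (\<lambda>x. ennreal (h x))"] by (simp add: assms(1) sp)
  finally show ?thesis .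
qed

text \<open>
  This turns integrability with respect to the signed measure \<open>\<nu>\<close> into ordinary integrability.
\<close>

lemma pos_part_measure:
  assumes "finite_measure \<nu>" "sets \<nu> = sets M"
  shows "pos_part M (measure \<nu>) = \<nu>"
proof -
  interpret finite_measure \<nu> by fact
  have "pos_part M (measure \<nu>) = density \<nu> (\<lambda>x. ennreal 1)"
  proof (rule pos_part_eq_density)
    show "measure \<nu> A = (LINT x:A|\<nu>. 1)" if "A \<in> sets M" for A
      using that assms(2) by (simp add: set_lebesgue_integral_def Int_absorb2 sets.sets_into_space)
  qed (use assms(2) in simp_all)
  then show ?thesis by (simp add: density_1)
qed

text \<open>
  The integral over the two Jordan parts recombines because \<open>h\<close> is the difference of
  \<open>max 0 h\<close> and \<open>max 0 (- h)\<close>. Once signed measures are represented by densities, the signed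
  integral is therefore visibly linear in the measure.
\<close>

lemma signed_integral_eq_density:
  assumes "sets \<mu> = sets M" and h: "integrable \<mu> h"
    and \<eta>: "\<And>A. A \<in> sets M \<Longrightarrow> \<eta> A = (LINT x:A|\<mu>. h x)"
    and f: "f \<in> borel_measurable M" and hf: "integrable \<mu> (\<lambda>x. h x * f x)"
  shows "signed_integral M \<eta> f = (LINT x|\<mu>. h x * f x)"
proof -
  have [measurable]: "h \<in> borel_measurable \<mu>" "f \<in> borel_measurable \<mu>"
    using h f measurable_cong_sets[OF assms(1) refl] by auto
  \<comment> \<open>\<open>integral_density\<close> needs nonnegative real densities, so the truncation is made explicit.\<close>
  have pos: "pos_part M \<eta> = density \<mu> (\<lambda>x. ennreal (max 0 (h x)))"
    using pos_part_eq_density[OF assms(1) h \<eta>] by (simp add: ennreal_max_0)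
  have "pos_part M (- \<eta>) = density \<mu> (\<lambda>x. ennreal (- h x))"
    using h by (intro pos_part_eq_density assms(1))
      (auto simp: \<eta> set_lebesgue_integral_def)
  then have neg: "pos_part M (- \<eta>) = density \<mu> (\<lambda>x. ennreal (max 0 (- h x)))"
    by (simp add: ennreal_max_0)
  have int: "integrable \<mu> (\<lambda>x. max 0 (h x) * f x)" "integrable \<mu> (\<lambda>x. max 0 (- h x) * f x)"
    by (auto intro!: Bochner_Integration.integrable_bound[OF hf] AE_I2 mult_right_mono
        simp: abs_mult)
  have "signed_integral M \<eta> f = (LINT x|\<mu>. max 0 (h x) * f x) - (LINT x|\<mu>. max 0 (- h x) * f x)"
    unfolding signed_integral_def pos neg by (simp add: integral_density del: ennreal_max_0 ennreal_max_0')
  also have "\<dots> = (LINT x|\<mu>. max 0 (h x) * f x - max 0 (- h x) * f x)"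
    using int by simp
  also have "\<dots> = (LINT x|\<mu>. h x * f x)"
    by (intro Bochner_Integration.integral_cong) (auto simp: max_def)
  finally show ?thesis .
qed

text \<open>
  The sum serves as a common dominating measure for the \<open>\<mu> i\<close>.
\<close>

lemma sum_of_finite_measures:
  assumes I: "finite I" and fin: "\<And>i. i \<in> I \<Longrightarrow> finite_measure (\<mu> i)"
    and sets: "\<And>i. i \<in> I \<Longrightarrow> sets (\<mu> i) = sets M"
  shows "\<exists>\<rho>. finite_measure \<rho> \<and> sets \<rho> = sets M \<and>
    (\<forall>A\<in>sets M. emeasure \<rho> A = (\<Sum>i\<in>I. emeasure (\<mu> i) A))"
proof -
  let ?\<rho> = "measure_of (space M) (sets M) (\<lambda>A. \<Sum>i\<in>I. emeasure (\<mu> i) A)"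
  have em: "emeasure ?\<rho> A = (\<Sum>i\<in>I. emeasure (\<mu> i) A)" if "A \<in> sets M" for A
  proof (rule emeasure_measure_of_sigma)
    show "sigma_algebra (space M) (sets M)" by (rule sets.sigma_algebra_axioms)
    show "positive (sets M) (\<lambda>A. \<Sum>i\<in>I. emeasure (\<mu> i) A)" by (simp add: positive_def)
    show "countably_additive (sets M) (\<lambda>A. \<Sum>i\<in>I. emeasure (\<mu> i) A)"
    proof (rule countably_additiveI)
      fix A :: "nat \<Rightarrow> _" assume A: "range A \<subseteq> sets M" "disjoint_family A"
      have "(\<Sum>n. \<Sum>i\<in>I. emeasure (\<mu> i) (A n)) = (\<Sum>i\<in>I. \<Sum>n. emeasure (\<mu> i) (A n))"
        by (rule suminf_sum) simp
      also have "\<dots> = (\<Sum>i\<in>I. emeasure (\<mu> i) (\<Union>n. A n))"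
        using A sets by (intro sum.cong refl suminf_emeasure) auto
      finally show "(\<Sum>n. \<Sum>i\<in>I. emeasure (\<mu> i) (A n)) = (\<Sum>i\<in>I. emeasure (\<mu> i) (\<Union>n. A n))" .
    qed
  qed fact
  have "(\<Sum>i\<in>I. emeasure (\<mu> i) (space M)) \<noteq> \<infinity>"
    using I fin by (simp add: finite_measure.emeasure_finite)
  then have "finite_measure ?\<rho>"
    by (intro finite_measureI) (simp add: em)
  then show ?thesis using em by (intro exI[of _ ?\<rho>]) simp
qed

lemma real_density_of_finite_measure:
  assumes "finite_measure \<rho>" "finite_measure \<mu>" "absolutely_continuous \<rho> \<mu>" "sets \<mu> = sets \<rho>"
  obtains h where "integrable \<rho> h" "\<And>x. 0 \<le> h x" "\<mu> = density \<rho> (\<lambda>x. ennreal (h x))"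
proof -
  interpret L: finite_measure \<rho> by fact
  interpret U: finite_measure \<mu> by fact
  obtain h where [measurable]: "h \<in> borel_measurable \<rho>" and RN: "AE x in \<rho>. RN_deriv \<rho> \<mu> x = ennreal (h x)"
    and nn: "\<And>x. 0 \<le> h x"
    using L.real_RN_deriv[OF assms(2-4)] by metis
  have eq: "\<mu> = density \<rho> (\<lambda>x. ennreal (h x))"
    using L.density_RN_deriv[OF assms(3,4)] density_cong[OF _ _ RN] by simp
  have "integrable \<mu> (\<lambda>x. 1::real)" by simp
  then have "integrable \<rho> h"
    unfolding eq using nn by (subst (asm) integrable_density) auto
  then show ?thesis using nn eq that by blast
qed

text \<open>
  The Jordan decomposition is not additive in the measure, so linearity of the signed integral
  cannot be read off from its definition. But all \<open>\<mu> i\<close> have densities \<open>h i\<close> with respect to the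
  single measure \<open>\<Sum>i\<in>I. \<mu> i\<close>, and there \<open>\<eta>\<close> has the density \<open>\<Sum>i\<in>I. c i * h i\<close>, whatever
  cancellation takes place between the \<open>\<mu> i\<close>.
\<close>

proposition signed_integral_linear_combination:
  assumes I: "finite I" and fin: "\<And>i. i \<in> I \<Longrightarrow> finite_measure (\<mu> i)"
    and sets: "\<And>i. i \<in> I \<Longrightarrow> sets (\<mu> i) = sets M"
    and \<eta>: "\<And>A. A \<in> sets M \<Longrightarrow> \<eta> A = (\<Sum>i\<in>I. c i * measure (\<mu> i) A)"
    and f: "f \<in> borel_measurable M" and int: "\<And>i. i \<in> I \<Longrightarrow> integrable (\<mu> i) f"
  shows "signed_integral M \<eta> f = (\<Sum>i\<in>I. c i * (LINT x|\<mu> i. f x))"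
proof -
  obtain \<rho> where \<rho>: "finite_measure \<rho>" "sets \<rho> = sets M"
    "\<And>A. A \<in> sets M \<Longrightarrow> emeasure \<rho> A = (\<Sum>i\<in>I. emeasure (\<mu> i) A)"
    using sum_of_finite_measures[of I \<mu> M] I fin sets by blast
  have "\<exists>h. integrable \<rho> h \<and> (\<forall>x. 0 \<le> h x) \<and> \<mu> i = density \<rho> (\<lambda>x. ennreal (h x))" if i: "i \<in> I" for i
  proof -
    have "absolutely_continuous \<rho> (\<mu> i)"
      unfolding absolutely_continuous_def null_sets_def using I i \<rho> sets by auto
    then show ?thesis
      using real_density_of_finite_measure[OF \<rho>(1) fin[OF i]] \<rho>(2) sets[OF i] by metis
  qed
  then obtain h where h: "\<And>i. i \<in> I \<Longrightarrow> integrable \<rho> (h i)" "\<And>i x. i \<in> I \<Longrightarrow> 0 \<le> h i x"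
    "\<And>i. i \<in> I \<Longrightarrow> \<mu> i = density \<rho> (\<lambda>x. ennreal (h i x))"
    by metis
  have f': "f \<in> borel_measurable \<rho>"
    using f measurable_cong_sets[OF \<rho>(2) refl] by auto
  have hf: "integrable \<rho> (\<lambda>x. h i x * f x)" "(LINT x|\<mu> i. f x) = (LINT x|\<rho>. h i x * f x)" if i: "i \<in> I" for i
  proof -
    show "integrable \<rho> (\<lambda>x. h i x * f x)"
      using int[OF i] f' h[OF i] by (simp add: integrable_density)
    show "(LINT x|\<mu> i. f x) = (LINT x|\<rho>. h i x * f x)"
      using f' h[OF i] by (simp add: integral_density)
  qed
  let ?h = "\<lambda>x. \<Sum>i\<in>I. c i * h i x"
  have "\<eta> A = (LINT x:A|\<rho>. ?h x)" if A: "A \<in> sets M" for A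
  proof -
    have ind: "integrable \<rho> (\<lambda>x. indicator A x * h i x)" if "i \<in> I" for i
      using integrable_mult_indicator[of A \<rho> "h i"] h(1)[OF that] A \<rho>(2) by simp
    have "measure (\<mu> i) A = (LINT x|\<rho>. indicator A x * h i x)" if i: "i \<in> I" for i
    proof -
      have "measure (\<mu> i) A = (LINT x|\<mu> i. indicator A x)"
        using A sets[OF i] by (simp add: Int_absorb2 sets.sets_into_space)
      also have "\<dots> = (LINT x|\<rho>. h i x *\<^sub>R indicator A x)"
        unfolding h(3)[OF i] using A \<rho>(2) h[OF i] by (intro integral_density) auto
      finally show ?thesis by (simp add: mult.commute)
    qed
    then have "\<eta> A = (\<Sum>i\<in>I. c i * (LINT x|\<rho>. indicator A x * h i x))"
      by (simp add: \<eta> A)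
    also have "\<dots> = (LINT x|\<rho>. (\<Sum>i\<in>I. c i * (indicator A x * h i x)))"
      using ind by (subst Bochner_Integration.integral_sum) auto
    also have "\<dots> = (LINT x:A|\<rho>. ?h x)"
      unfolding set_lebesgue_integral_def
      by (intro Bochner_Integration.integral_cong) (auto simp: sum_distrib_left ac_simps)
    finally show ?thesis .
  qed
  moreover have "integrable \<rho> ?h" using h(1) by auto
  moreover have sum: "(\<lambda>x. ?h x * f x) = (\<lambda>x. \<Sum>i\<in>I. c i * (h i x * f x))"
    by (simp add: sum_distrib_right mult.assoc)
  moreover have "integrable \<rho> (\<lambda>x. \<Sum>i\<in>I. c i * (h i x * f x))" using hf by auto
  ultimately have "signed_integral M \<eta> f = (LINT x|\<rho>. (\<Sum>i\<in>I. c i * (h i x * f x)))"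
    using signed_integral_eq_density[OF \<rho>(2) _ _ f, of ?h \<eta>] by simp
  also have "\<dots> = (\<Sum>i\<in>I. c i * (LINT x|\<mu> i. f x))"
    using hf by (subst Bochner_Integration.integral_sum) auto
  finally show ?thesis .
qed

section \<open>Continuity of integration on a Banach function space\<close>

context banach_function_space
begin

lemma nrm_zero: "nrm 0 = 0"
  using nrm_eq_0_iff[OF zero_mem] by simp

lemma nrm_pos: "f \<in> F \<Longrightarrow> f \<noteq> 0 \<Longrightarrow> 0 < nrm f"
  using nrm_nonneg nrm_eq_0_iff by (simp add: less_le)

lemma diff_mem: "f \<in> F \<Longrightarrow> g \<in> F \<Longrightarrow> f - g \<in> F"
  using add_mem[of f "\<lambda>x. (-1) * g x"] scale_mem[of g "-1"] by (simp add: func_plus fun_diff_def)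

lemma nrm_minus_commute: "f \<in> F \<Longrightarrow> g \<in> F \<Longrightarrow> nrm (f - g) = nrm (g - f)"
  using nrm_scale[OF diff_mem[of g f], of "-1"] by (simp add: fun_diff_def)

text \<open>
  The locale \<^locale>\<open>Metric_space\<close> asks for symmetry and nonnegativity on the whole type, whereas
  nothing is known about \<open>nrm\<close> outside \<open>F\<close>; hence the value 0 there.
\<close>

definition fdist :: "('a \<Rightarrow> real) \<Rightarrow> ('a \<Rightarrow> real) \<Rightarrow> real" where
  "fdist f g = (if f \<in> F \<and> g \<in> F then nrm (f - g) else 0)"

sublocale fmetric: Metric_space F fdist
proof
  show "0 \<le> fdist f g" for f g by (simp add: fdist_def diff_mem nrm_nonneg)
  show "fdist f g = fdist g f" for f g by (auto simp: fdist_def nrm_minus_commute)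
  show "fdist f g = 0 \<longleftrightarrow> f = g" if "f \<in> F" "g \<in> F" for f g
    using that nrm_eq_0_iff[OF diff_mem[of f g]] by (auto simp: fdist_def fun_eq_iff)
  show "fdist f k \<le> fdist f g + fdist g k" if "f \<in> F" "g \<in> F" "k \<in> F" for f g k
  proof -
    have "f - k = (f - g) + (g - k)" by (simp add: fun_eq_iff)
    then show ?thesis
      using that nrm_triangle[of "f - g" "g - k"] by (simp add: fdist_def diff_mem)
  qed
qed

lemma mcomplete_fdist: "fmetric.mcomplete"
  unfolding fmetric.mcomplete_def
proof (intro allI impI)
  fix s assume s: "fmetric.MCauchy s"
  then have F: "s n \<in> F" for n by (auto simp: fmetric.MCauchy_def)
  have "\<exists>N. \<forall>m\<ge>N. \<forall>n\<ge>N. nrm (s m - s n) < e" if "0 < e" for e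
    using s that F unfolding fmetric.MCauchy_def fdist_def by simp
  then obtain f where "f \<in> F" "(\<lambda>n. nrm (s n - f)) \<longlonglongrightarrow> 0"
    using complete F by blast
  then have "limitin fmetric.mtopology s f sequentially"
    using F by (simp add: fmetric.limitin_metric_dist_null fdist_def)
  then show "\<exists>f. limitin fmetric.mtopology s f sequentially" by blast
qed

lemma limitin_imp_pointwise:
  assumes bpe: "bounded_point_evaluation M F nrm" and s: "\<And>n. s n \<in> F"
    and lim: "limitin fmetric.mtopology s f sequentially"
  shows "(\<lambda>n. s n x) \<longlonglongrightarrow> f x"
proof (cases "x \<in> space M")
  case True
  have f: "f \<in> F" and null: "(\<lambda>n. nrm (s n - f)) \<longlonglongrightarrow> 0"
    using lim s by (auto simp: fmetric.limitin_metric_dist_null fdist_def)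
  obtain K where K: "\<And>g. g \<in> F - {0} \<Longrightarrow> \<bar>g x\<bar> / nrm g \<le> K"
    using bpe True unfolding bounded_point_evaluation_def bdd_above_def by blast
  have "\<bar>g x\<bar> \<le> K * nrm g" if "g \<in> F" for g
  proof (cases "g = 0")
    case False
    then have "0 < nrm g" using that nrm_pos by blast
    then show ?thesis using K[of g] that False by (simp add: field_simps)
  qed (simp add: nrm_zero)
  then have "norm (s n x - f x) \<le> K * nrm (s n - f)" for n
    using diff_mem[OF s f, of n] by fastforce
  moreover have "(\<lambda>n. K * nrm (s n - f)) \<longlonglongrightarrow> 0"
    using tendsto_mult_right_zero[OF null] .
  ultimately have "(\<lambda>n. s n x - f x) \<longlonglongrightarrow> 0"
    using Lim_null_comparison[of "\<lambda>n. s n x - f x" "\<lambda>n. K * nrm (s n - f)" sequentially] by simp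
  then show ?thesis by (rule LIM_zero_cancel)
next
  case False
  then show ?thesis
    using zero_outside[OF s] zero_outside[OF fmetric.limitin_mspace[OF lim]] by simp
qed

text \<open>
  By bounded point evaluation, convergence in \<open>F\<close> is pointwise, so Fatou's lemma makes the
  \<open>L\<^sup>1\<close>-seminorm lower semicontinuous on \<open>F\<close>.
\<close>

lemma closedin_L1_sublevel:
  assumes bpe: "bounded_point_evaluation M F nrm"
    and int: "\<And>f. f \<in> F \<Longrightarrow> integrable \<mu> f"
  shows "closedin fmetric.mtopology {f \<in> F. (LINT x|\<mu>. \<bar>f x\<bar>) \<le> real n}" (is "closedin _ ?A")
  unfolding fmetric.metric_closedin_iff_sequentially_closed
proof (intro conjI allI impI)
  fix s f assume *: "range s \<subseteq> ?A \<and> limitin fmetric.mtopology s f sequentially"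
  then have s: "s k \<in> F" "(LINT x|\<mu>. \<bar>s k x\<bar>) \<le> real n" for k by auto
  have f: "f \<in> F" using * by (simp add: fmetric.limitin_metric_dist_null)
  have conv: "(\<lambda>k. ennreal \<bar>s k x\<bar>) \<longlonglongrightarrow> ennreal \<bar>f x\<bar>" for x
    using limitin_imp_pointwise[OF bpe s(1)] * by (intro tendsto_ennrealI tendsto_rabs) auto
  have ms: "s k \<in> borel_measurable \<mu>" for k using int[OF s(1)] by auto
  have "ennreal (LINT x|\<mu>. \<bar>f x\<bar>) = (\<integral>\<^sup>+x. ennreal \<bar>f x\<bar> \<partial>\<mu>)"
    using int[OF f] by (intro nn_integral_eq_integral[symmetric]) auto
  also have "\<dots> = (\<integral>\<^sup>+x. liminf (\<lambda>k. ennreal \<bar>s k x\<bar>) \<partial>\<mu>)"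
    using lim_imp_Liminf[OF sequentially_bot conv] by simp
  also have "\<dots> \<le> liminf (\<lambda>k. \<integral>\<^sup>+x. ennreal \<bar>s k x\<bar> \<partial>\<mu>)"
    using ms by (intro nn_integral_liminf) simp
  also have "\<dots> \<le> liminf (\<lambda>k. ennreal (real n))"
  proof (intro Liminf_mono always_eventually allI)
    fix k
    have "(\<integral>\<^sup>+x. ennreal \<bar>s k x\<bar> \<partial>\<mu>) = ennreal (LINT x|\<mu>. \<bar>s k x\<bar>)"
      using int[OF s(1)] by (intro nn_integral_eq_integral) auto
    also have "\<dots> \<le> ennreal (real n)" using s(2) by (rule ennreal_leI)
    finally show "(\<integral>\<^sup>+x. ennreal \<bar>s k x\<bar> \<partial>\<mu>) \<le> ennreal (real n)" .
  qed
  finally have "(LINT x|\<mu>. \<bar>f x\<bar>) \<le> real n" by (simp add: Liminf_const)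
  then show "f \<in> ?A" using f by simp
qed auto

text \<open>
  A finite lower semicontinuous seminorm \<open>p\<close> on a Banach space is bounded: the closed sets
  \<open>{p \<le> n}\<close> cover the space, so by Baire's theorem one of them contains a ball, say around \<open>g\<close>.
  For \<open>u\<close> in the ball of the same radius around 0, \<open>2 u = (g + u) - (g - u)\<close> then gives
  \<open>p u \<le> n\<close>. Here \<open>p\<close> is the \<open>L\<^sup>1(\<mu>)\<close>-seminorm, which dominates the integral.
\<close>

proposition integral_bounded:
  assumes bpe: "bounded_point_evaluation M F nrm"
    and int: "\<And>f. f \<in> F \<Longrightarrow> integrable \<mu> f"
  shows "\<exists>K. \<forall>f\<in>F. \<bar>LINT x|\<mu>. f x\<bar> \<le> K * nrm f"
proof -
  define A where "A n = {f \<in> F. (LINT x|\<mu>. \<bar>f x\<bar>) \<le> real n}" for n :: nat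
  have "\<Union>(range A) = F"
    using real_arch_simple by (auto simp: A_def)
  then have "fmetric.mtopology interior_of \<Union>(range A) = F"
    by (metis fmetric.topspace_mtopology interior_of_topspace)
  then obtain n where "fmetric.mtopology interior_of A n \<noteq> {}"
    using fmetric.metric_Baire_category_alt[OF mcomplete_fdist, of "range A"]
      closedin_L1_sublevel[OF bpe int] zero_mem unfolding A_def by auto
  then obtain g r where g: "g \<in> F" and r: "0 < r" and ball: "fmetric.mcball g r \<subseteq> A n"
    unfolding fmetric.metric_interior_of_alt by auto
  have near: "(LINT x|\<mu>. \<bar>k x\<bar>) \<le> real n" if "k \<in> F" "nrm (k - g) \<le> r" for k
  proof -
    have "k \<in> fmetric.mcball g r"
      using that g nrm_minus_commute[of k g] by (simp add: fdist_def)
    then show ?thesis using ball by (auto simp: A_def)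
  qed
  have "\<bar>LINT x|\<mu>. f x\<bar> \<le> real n / r * nrm f" if f: "f \<in> F" for f
  proof (cases "f = 0")
    case True
    then show ?thesis by (simp add: nrm_zero)
  next
    case False
    then have pos: "0 < nrm f" using f nrm_pos by blast
    define t where "t = r / nrm f"
    have t: "0 < t" using pos r by (simp add: t_def)
    define u where "u = (\<lambda>x. t * f x)"
    have u: "u \<in> F" "nrm u = r"
      using scale_mem[OF f, of t] nrm_scale[OF f, of t] t pos r by (simp_all add: u_def t_def)
    have "nrm (g + u - g) \<le> r" "nrm (g - u - g) \<le> r"
      using u nrm_scale[OF u(1), of "-1"] by (simp_all add: fun_diff_def func_plus)
    then have le: "(LINT x|\<mu>. \<bar>(g + u) x\<bar>) \<le> real n" "(LINT x|\<mu>. \<bar>(g - u) x\<bar>) \<le> real n"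
      using near[OF add_mem[OF g u(1)]] near[OF diff_mem[OF g u(1)]] by blast+
    have i: "integrable \<mu> (\<lambda>x. \<bar>(g + u) x\<bar>)" "integrable \<mu> (\<lambda>x. \<bar>(g - u) x\<bar>)"
      by (rule integrable_abs[OF int[OF add_mem[OF g u(1)]]], rule integrable_abs[OF int[OF diff_mem[OF g u(1)]]])
    have "2 * t * \<bar>LINT x|\<mu>. f x\<bar> \<le> 2 * t * (LINT x|\<mu>. \<bar>f x\<bar>)"
      using t by (intro mult_left_mono integral_abs_bound) auto
    also have "\<dots> = (LINT x|\<mu>. 2 * \<bar>u x\<bar>)"
      using t by (simp add: u_def abs_mult)
    also have "\<dots> \<le> (LINT x|\<mu>. \<bar>(g + u) x\<bar> + \<bar>(g - u) x\<bar>)"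
      using i int[OF u(1)] by (intro integral_mono) auto
    also have "\<dots> \<le> 2 * real n" using le i by simp
    finally have "t * \<bar>LINT x|\<mu>. f x\<bar> \<le> real n" by simp
    then show ?thesis using pos r by (simp add: t_def field_simps)
  qed
  then show ?thesis by blast
qed

text \<open>
  Being a supremum of reals, \<^const>\<open>DSC_D\<close> bounds the quotients only if these are bounded
  above. This is where continuity of integration enters, applied to both Jordan parts of \<open>\<eta>\<close>.
\<close>

lemma abs_signed_integral_le_DSC_D:
  assumes bpe: "bounded_point_evaluation M F nrm"
    and \<eta>: "\<eta> \<in> signed_measures_on M F" and f: "f \<in> F"
  shows "\<bar>signed_integral M \<eta> f\<bar> \<le> DSC_D M F nrm \<eta> * nrm f"
proof -
  have int: "integrable (pos_part M \<eta>) g" "integrable (pos_part M (- \<eta>)) g" if "g \<in> F" for g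
    using \<eta> that by (auto simp: signed_measures_on_def signed_integrable_def)
  obtain K where K: "\<And>g. g \<in> F \<Longrightarrow> \<bar>LINT x|pos_part M \<eta>. g x\<bar> \<le> K * nrm g"
    using integral_bounded[OF bpe, of "pos_part M \<eta>"] int(1) by blast
  obtain L where L: "\<And>g. g \<in> F \<Longrightarrow> \<bar>LINT x|pos_part M (- \<eta>). g x\<bar> \<le> L * nrm g"
    using integral_bounded[OF bpe, of "pos_part M (- \<eta>)"] int(2) by blast
  have KL: "\<bar>signed_integral M \<eta> g\<bar> \<le> (K + L) * nrm g" if "g \<in> F" for g
    using K[OF that] L[OF that] by (auto simp: signed_integral_def distrib_right)
  have "bdd_above (insert 0 ((\<lambda>f. \<bar>signed_integral M \<eta> f\<bar> / nrm f) ` (F - {0})))"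
    unfolding bdd_above_insert
  proof (rule bdd_aboveI2)
    fix g assume "g \<in> F - {0}"
    then show "\<bar>signed_integral M \<eta> g\<bar> / nrm g \<le> K + L"
      using KL[of g] nrm_pos[of g] by (simp add: field_simps)
  qed
  note upper = cSup_upper[OF _ this, folded DSC_D_def]
  show ?thesis
  proof (cases "f = 0")
    case True
    then show ?thesis using KL[OF f] by (simp add: nrm_zero)
  next
    case False
    then have "\<bar>signed_integral M \<eta> f\<bar> / nrm f \<le> DSC_D M F nrm \<eta>"
      using f by (intro upper) auto
    then show ?thesis using nrm_pos[OF f False] by (simp add: field_simps)
  qed
qed

end

section \<open>The confounding factor\<close>

text \<open>
  The bound gives both claims. In particular it forces the integral to vanish whenever variation
  or discrepancy does, which is what makes the default value 0 of \<^const>\<open>CNF_D\<close> correct.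
\<close>

lemma CNF_D_factorization:
  assumes bound: "\<bar>signed_integral M \<eta> f\<bar> \<le> DSC_D M F nrm \<eta> * VAR_D M nrm T f"
  shows "signed_integral M \<eta> f = CNF_D M F nrm T f \<eta> * DSC_D M F nrm \<eta> * VAR_D M nrm T f"
    and "\<bar>CNF_D M F nrm T f \<eta>\<bar> \<le> 1"
proof -
  let ?P = "VAR_D M nrm T f * DSC_D M F nrm \<eta>"
  have b: "\<bar>signed_integral M \<eta> f\<bar> \<le> ?P" using bound by (simp add: mult.commute)
  show "signed_integral M \<eta> f = CNF_D M F nrm T f \<eta> * DSC_D M F nrm \<eta> * VAR_D M nrm T f"
    using b by (auto simp: CNF_D_def)
  show "\<bar>CNF_D M F nrm T f \<eta>\<bar> \<le> 1"
    using b by (auto simp: CNF_D_def abs_divide divide_le_eq)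
qed

section \<open>Differences between a measure and a sampling measure\<close>

lemma integrable_return:
  fixes f :: "'a \<Rightarrow> real"
  assumes "x \<in> space M" "f \<in> borel_measurable M"
  shows "integrable (return M x) f"
  using assms by (intro integrableI_bounded) (auto simp: nn_integral_return)

lemma signed_integral_sampling:
  fixes n :: nat and w :: "nat \<Rightarrow> real"
  assumes "\<And>i. i < n \<Longrightarrow> x i \<in> space M" "f \<in> borel_measurable M"
  shows "signed_integral M (\<lambda>A. \<Sum>i<n. w i * measure (return M (x i)) A) f = (\<Sum>i<n. w i * f (x i))"
proof -
  have "signed_integral M (\<lambda>A. \<Sum>i<n. w i * measure (return M (x i)) A) f
      = (\<Sum>i<n. w i * (LINT y|return M (x i). f y))"
    by (rule signed_integral_linear_combination, goal_cases)
      (use assms in \<open>auto intro: integrable_return prob_space.finite_measure prob_space_return\<close>)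
  then show ?thesis using assms by (simp add: integral_return)
qed

lemma signed_integral_measure_minus_sampling:
  assumes \<nu>: "finite_measure \<nu>" "sets \<nu> = sets M" "integrable \<nu> f"
    and \<nu>': "\<nu>' \<in> sampling_measures M" and f: "f \<in> borel_measurable M"
  shows "signed_integral M (measure \<nu> - \<nu>') f = (LINT x|\<nu>. f x) - signed_integral M \<nu>' f"
proof -
  obtain n :: nat and w x where x: "\<And>i. i < n \<Longrightarrow> x i \<in> space M"
    and eq: "\<nu>' = (\<lambda>A. \<Sum>i<n. w i * measure (return M (x i)) A)"
    using \<nu>' unfolding sampling_measures_def by blast
  \<comment> \<open>\<open>\<nu> - \<nu>'\<close> as one linear combination: index 0 is \<open>\<nu>\<close>, the points are shifted by one\<close>
  define \<mu> where "\<mu> i = (case i of 0 \<Rightarrow> \<nu> | Suc j \<Rightarrow> return M (x j))" for i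
  define c where "c i = (case i of 0 \<Rightarrow> 1 | Suc j \<Rightarrow> - w j)" for i
  have "signed_integral M (measure \<nu> - \<nu>') f = (\<Sum>i<Suc n. c i * (LINT y|\<mu> i. f y))"
  proof (rule signed_integral_linear_combination)
    show "finite_measure (\<mu> i)" "sets (\<mu> i) = sets M" "integrable (\<mu> i) f" if "i \<in> {..<Suc n}" for i
      using that \<nu> x f
      by (auto simp: \<mu>_def split: nat.split
            intro: integrable_return prob_space.finite_measure prob_space_return)
    show "(measure \<nu> - \<nu>') A = (\<Sum>i<Suc n. c i * measure (\<mu> i) A)" for A
      by (simp add: eq \<mu>_def c_def sum.lessThan_Suc_shift sum_negf del: sum.lessThan_Suc)
  qed (use f in auto)
  also have "\<dots> = (LINT x|\<nu>. f x) - (\<Sum>i<n. w i * f (x i))"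
    using x f by (simp add: \<mu>_def c_def sum.lessThan_Suc_shift sum_negf integral_return
        del: sum.lessThan_Suc)
  finally show ?thesis
    using signed_integral_sampling[of n x M f w] x f by (simp add: eq)
qed

lemma integral_const_on:
  assumes "sets \<nu> = sets M"
  shows "(LINT x|\<nu>. const_on M c x) = c * measure \<nu> (space M)"
proof -
  have "(LINT x|\<nu>. const_on M c x) = (LINT x|\<nu>. c)"
    using sets_eq_imp_space_eq[OF assms]
    by (intro Bochner_Integration.integral_cong) (auto simp: const_on_def)
  then show ?thesis using sets_eq_imp_space_eq[OF assms] by simp
qed

text \<open>
  The total mass of \<open>\<nu> - \<nu>'\<close> is the coefficient of \<open>c\<close> in the integral of the constant. With it
  zero, the error of \<open>f\<close> can be estimated by the norm of \<open>f - T f\<close> instead of that of \<open>f\<close>.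
\<close>

lemma signed_integral_minus_const_on:
  assumes \<nu>: "finite_measure \<nu>" "sets \<nu> = sets M" "integrable \<nu> f"
    and \<nu>': "\<nu>' \<in> sampling_measures M" and f: "f \<in> borel_measurable M"
    and zero: "(measure \<nu> - \<nu>') (space M) = 0"
  shows "signed_integral M (measure \<nu> - \<nu>') (f - const_on M c) = signed_integral M (measure \<nu> - \<nu>') f"
proof -
  obtain n :: nat and w x where x: "\<And>i. i < n \<Longrightarrow> x i \<in> space M"
    and eq: "\<nu>' = (\<lambda>A. \<Sum>i<n. w i * measure (return M (x i)) A)"
    using \<nu>' unfolding sampling_measures_def by blast
  interpret finite_measure \<nu> by fact
  have mc: "const_on M c \<in> borel_measurable M"
    unfolding const_on_def by (subst measurable_cong[of M _ "\<lambda>x. c"]) auto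
  have ic: "integrable \<nu> (const_on M c)"
    unfolding const_on_def using sets_eq_imp_space_eq[OF \<nu>(2)]
    by (subst Bochner_Integration.integrable_cong[of \<nu> \<nu> _ "\<lambda>x. c"]) auto
  have m: "f - const_on M c \<in> borel_measurable M" and i: "integrable \<nu> (f - const_on M c)"
    using f mc \<nu>(3) ic by (auto simp: fun_diff_def)
  have mass: "measure \<nu> (space M) = (\<Sum>i<n. w i)"
    using zero x by (simp add: eq measure_return)
  have "(\<Sum>i<n. w i * (f - const_on M c) (x i)) = (\<Sum>i<n. w i * f (x i)) - c * (\<Sum>i<n. w i)"
    using x by (simp add: const_on_def right_diff_distrib sum_subtractf sum_distrib_left mult.commute)
  moreover have "(LINT x|\<nu>. (f - const_on M c) x) = (LINT x|\<nu>. f x) - c * measure \<nu> (space M)"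
    using \<nu>(3) ic by (simp add: integral_const_on[OF \<nu>(2)])
  ultimately show ?thesis
    using signed_integral_measure_minus_sampling[OF \<nu>(1,2) i \<nu>' m]
      signed_integral_measure_minus_sampling[OF \<nu> \<nu>' f]
      signed_integral_sampling[of n x M f w] signed_integral_sampling[of n x M "f - const_on M c" w]
    by (simp add: eq x f m mass)
qed

theorem theorem1:
  fixes M \<nu> :: "'a measure"
    and F :: "('a \<Rightarrow> real) set"
    and nrm T :: "('a \<Rightarrow> real) \<Rightarrow> real"
    and f :: "'a \<Rightarrow> real"
    and \<nu>' :: "'a set \<Rightarrow> real"
  assumes points: "\<And>x. x \<in> space M \<Longrightarrow> {x} \<in> sets M"
    and "prob_space \<nu>" and "sets \<nu> = sets M"
    and "banach_function_space M F nrm"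
    and "bounded_point_evaluation M F nrm"
    and "bounded_linear_functional_on F nrm T"
    and "T ` F \<noteq> {0} \<Longrightarrow> (\<forall>c. const_on M c \<in> F)"
    and "measure \<nu> \<in> signed_measures_on M F"
    and "f \<in> F"
    and "\<nu>' \<in> sampling_measures M"
    and "measure \<nu> - \<nu>' \<in> signed_measures_perp M F T"
  shows "(LINT x|\<nu>. f x) - signed_integral M \<nu>' f
           = CNF_D M F nrm T f (measure \<nu> - \<nu>') * DSC_D M F nrm (measure \<nu> - \<nu>') * VAR_D M nrm T f
         \<and> \<bar>CNF_D M F nrm T f (measure \<nu> - \<nu>')\<bar> \<le> 1"
proof -
  let ?\<eta> = "measure \<nu> - \<nu>'"
  interpret \<nu>: prob_space \<nu> by fact
  interpret banach_function_space M F nrm by fact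
  have fin: "finite_measure \<nu>" by (rule \<nu>.finite_measure_axioms)
  have mf: "f \<in> borel_measurable M" by (rule measurable) fact
  have int: "integrable \<nu> f"
    using \<open>measure \<nu> \<in> signed_measures_on M F\<close> \<open>f \<in> F\<close> pos_part_measure[OF fin \<open>sets \<nu> = sets M\<close>]
    by (simp add: signed_measures_on_def signed_integrable_def)
  note diff = signed_integral_measure_minus_sampling[OF fin \<open>sets \<nu> = sets M\<close> int \<open>\<nu>' \<in> _\<close> mf]
  have \<eta>: "?\<eta> \<in> signed_measures_on M F"
    using \<open>?\<eta> \<in> signed_measures_perp M F T\<close> by (auto simp: signed_measures_perp_def split: if_splits)
  \<comment> \<open>Either \<open>T\<close> vanishes and nothing is subtracted, or the difference measure has mass 0.\<close>
  have "f - const_on M (T f) \<in> F \<and>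
      signed_integral M ?\<eta> (f - const_on M (T f)) = signed_integral M ?\<eta> f"
  proof (cases "T ` F = {0}")
    case True
    then have "T f = 0" using \<open>f \<in> F\<close> by blast
    then have "f - const_on M (T f) = f" by (auto simp: const_on_def fun_eq_iff)
    then show ?thesis using \<open>f \<in> F\<close> by simp
  next
    case False
    then have "?\<eta> (space M) = 0"
      using \<open>?\<eta> \<in> signed_measures_perp M F T\<close> by (simp add: signed_measures_perp_def)
    moreover have "const_on M (T f) \<in> F" using assms(7) False by blast
    ultimately show ?thesis
      using signed_integral_minus_const_on[OF fin \<open>sets \<nu> = sets M\<close> int \<open>\<nu>' \<in> _\<close> mf] \<open>f \<in> F\<close>
      by (simp add: diff_mem)
  qed
  then have "\<bar>signed_integral M ?\<eta> f\<bar> \<le> DSC_D M F nrm ?\<eta> * VAR_D M nrm T f"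
    using abs_signed_integral_le_DSC_D[OF \<open>bounded_point_evaluation M F nrm\<close> \<eta>]
    unfolding VAR_D_def by metis
  from CNF_D_factorization[OF this] show ?thesis by (simp add: diff)
qed

end
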